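(* Fix $d,k\in\mathbb{N}$. Let $\nu$ be a square-integrable probability measure on $\mathbb{R}^d$, i.e. $\int_{\mathbb{R}^d}\|x\|_2^2\,d\nu(x)<\infty$. For $\alpha>0$, let $A_{\star,\alpha}$ be a solution of $$\min_{A\in\{\mathbb{R}^d\}^k}F_{\nu,\alpha}(A)\quad\text{subject to}\quad A\subset\mathrm{co}(\mathrm{supp}(\nu)).$$ Let $\bar x=\int_{\mathbb{R}^d}x\,d\nu(x)$ and let $A_{\star,\infty}=\{\bar x\}^k$ be the collection consisting of $k$ copies of $\bar x$. Then for all sufficiently large $\alpha$, $$d_{2,\infty}(A_{\star,\alpha},A_{\star,\infty})\le 8k^{1/2}\alpha^{-1/4}\left(\int_{\mathbb{R}^d}\|x-\bar x\|_2^2\,d\nu(x)\right)^{1/2}.$$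
   Context: $[k]=\{1,\dots,k\}$. $\{\mathbb{R}^d\}^k$ denotes the set of unordered collections $A=\{a_\ell\}_{\ell\in[k]}$ of $k$ points of $\mathbb{R}^d$ (repetitions allowed), i.e. $(\mathbb{R}^d)^k$ modulo permutation of components. $\mathrm{co}(\cdot)$ denotes convex hull and $d(x,S)=\inf_{y\in S}\|x-y\|_2$. The variance-regularized objective is $$F_{\nu,\alpha}(A)=\left(\int_{\mathbb{R}^d}d^2(x,\mathrm{co}(A))\,d\nu(x)+\frac{\alpha}{k}\sum_{\ell\in[k]}\|a_\ell-\bar a\|_2^2\right)^{1/2},\qquad \bar a=\frac1k\sum_{\ell\in[k]}a_\ell.$$ The metric $d_{2,\infty}$ on $\{\mathbb{R}^d\}^k$ is $$d_{2,\infty}(\{a_\ell\}_{\ell\in[k]},\{b_\ell\}_{\ell\in[k]})=\min_{\sigma\in S[k]}\max_{\ell\in[k]}\|a_{\sigma(\ell)}-b_\ell\|_2,$$ where $S[k]$ is the set of permutations of $[k]$. *)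

theory Defs
  imports "HOL-Probability.Probability" "HOL-Combinatorics.Combinatorics"
begin

definition msupport :: "'a::topological_space measure \<Rightarrow> 'a set" where
  "msupport \<nu> = {x. \<forall>U. open U \<longrightarrow> x \<in> U \<longrightarrow> emeasure \<nu> U > 0}"

definition barycenter :: "'a::euclidean_space measure \<Rightarrow> 'a" where
  "barycenter \<nu> = (\<integral>x. x \<partial>\<nu>)"

text \<open>
  An unordered collection of \<open>k\<close> points, repetitions allowed, is a multiset of size \<open>k\<close>.
\<close>

definition mset_mean :: "'a::euclidean_space multiset \<Rightarrow> 'a" where
  "mset_mean A = (1 / real (size A)) *\<^sub>R (\<Sum>a\<in>#A. a)"

definition objective :: "'a::euclidean_space measure \<Rightarrow> real \<Rightarrow> 'a multiset \<Rightarrow> real" where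
  "objective \<nu> \<alpha> A =
     sqrt ((\<integral>x. (infdist x (convex hull (set_mset A)))\<^sup>2 \<partial>\<nu>)
           + \<alpha> / real (size A) * (\<Sum>a\<in>#A. (norm (a - mset_mean A))\<^sup>2))"

definition is_solution ::
    "'a::euclidean_space measure \<Rightarrow> nat \<Rightarrow> real \<Rightarrow> 'a multiset \<Rightarrow> bool" where
  "is_solution \<nu> k \<alpha> A \<longleftrightarrow>
     is_arg_min (objective \<nu> \<alpha>)
       (\<lambda>B. size B = k \<and> set_mset B \<subseteq> convex hull (msupport \<nu>)) A"

text \<open>
  The metric \<open>d\<^sub>2\<^sub>,\<^sub>\<infinity>\<close> is first defined on tuples, that is, on lists of equal nonzero length, with
  entries indexed from \<open>0\<close>. It does not change when the entries of either list are reordered, so it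
  passes to multisets of equal size through any choice of enumerations; the lemma
  \<open>dist_2_inf_mset\<close> states this.
\<close>

definition dist_2_inf_list :: "'a::euclidean_space list \<Rightarrow> 'a list \<Rightarrow> real" where
  "dist_2_inf_list as bs =
     (MIN \<sigma>\<in>{\<sigma>. \<sigma> permutes {..<length bs}}. MAX l\<in>{..<length bs}. norm (as ! \<sigma> l - bs ! l))"

definition dist_2_inf :: "'a::euclidean_space multiset \<Rightarrow> 'a multiset \<Rightarrow> real" where
  "dist_2_inf A B = dist_2_inf_list (SOME as. mset as = A) (SOME bs. mset bs = B)"

lemma dist_2_inf_list_permute_left:
  assumes \<pi>: "\<pi> permutes {..<length as}" and len: "length as = length bs"
  shows "dist_2_inf_list (permute_list \<pi> as) bs = dist_2_inf_list as bs"
proof -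
  let ?S = "{\<sigma>. \<sigma> permutes {..<length bs}}"
  let ?f = "\<lambda>\<sigma>. MAX l\<in>{..<length bs}. norm (as ! \<sigma> l - bs ! l)"
  have \<pi>': "\<pi> permutes {..<length bs}" using \<pi> len by simp
  have eq: "(MAX l\<in>{..<length bs}. norm (permute_list \<pi> as ! \<sigma> l - bs ! l)) = ?f (\<pi> \<circ> \<sigma>)"
    if "\<sigma> \<in> ?S" for \<sigma>
  proof (rule arg_cong[where f = Max], rule image_cong[OF refl])
    fix l assume "l \<in> {..<length bs}"
    then have "\<sigma> l < length as"
      using that len permutes_in_image[of \<sigma> "{..<length bs}" l] by auto
    then show "norm (permute_list \<pi> as ! \<sigma> l - bs ! l) = norm (as ! (\<pi> \<circ> \<sigma>) l - bs ! l)"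
      using \<pi> by (simp add: permute_list_nth)
  qed
  have "(\<lambda>\<sigma>. MAX l\<in>{..<length bs}. norm (permute_list \<pi> as ! \<sigma> l - bs ! l)) ` ?S
      = ?f ` ((\<circ>) \<pi> ` ?S)"
    unfolding image_image using eq by (rule image_cong[OF refl])
  also have "(\<circ>) \<pi> ` ?S = ?S"
    using image_compose_permutations_left[OF \<pi>'] by (auto simp: image_def)
  finally show ?thesis by (simp add: dist_2_inf_list_def)
qed

lemma dist_2_inf_list_permute_right:
  assumes \<pi>: "\<pi> permutes {..<length bs}" and len: "length as = length bs"
  shows "dist_2_inf_list as (permute_list \<pi> bs) = dist_2_inf_list as bs"
proof -
  let ?S = "{\<sigma>. \<sigma> permutes {..<length bs}}"
  let ?f = "\<lambda>\<sigma>. MAX l\<in>{..<length bs}. norm (as ! \<sigma> l - permute_list \<pi> bs ! l)"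
  let ?g = "\<lambda>\<sigma>. MAX l\<in>{..<length bs}. norm (as ! \<sigma> l - bs ! l)"
  have eq: "?f (\<sigma> \<circ> \<pi>) = ?g \<sigma>" for \<sigma>
  proof -
    have "(\<lambda>l. norm (as ! (\<sigma> \<circ> \<pi>) l - permute_list \<pi> bs ! l)) ` {..<length bs}
        = (\<lambda>l. norm (as ! \<sigma> l - bs ! l)) ` (\<pi> ` {..<length bs})"
      unfolding image_image using \<pi> by (intro image_cong) (auto simp: permute_list_nth)
    also have "\<pi> ` {..<length bs} = {..<length bs}" using \<pi> by (rule permutes_image)
    finally show ?thesis by (rule arg_cong)
  qed
  have "?g ` ?S = ?f ` ((\<lambda>\<sigma>. \<sigma> \<circ> \<pi>) ` ?S)"
    unfolding image_image using eq by (intro image_cong) auto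
  also have "(\<lambda>\<sigma>. \<sigma> \<circ> \<pi>) ` ?S = ?S"
    using image_compose_permutations_right[OF \<pi>] by (auto simp: image_def)
  finally show ?thesis by (simp add: dist_2_inf_list_def)
qed

lemma dist_2_inf_mset:
  assumes "length as = length bs"
  shows "dist_2_inf (mset as) (mset bs) = dist_2_inf_list as bs"
proof -
  define as' bs' where "as' = (SOME xs. mset xs = mset as)" and "bs' = (SOME xs. mset xs = mset bs)"
  have as': "mset as' = mset as" unfolding as'_def by (rule someI) (rule refl)
  have bs': "mset bs' = mset bs" unfolding bs'_def by (rule someI) (rule refl)
  obtain \<pi> where \<pi>: "\<pi> permutes {..<length as}" "permute_list \<pi> as = as'"
    using mset_eq_permutation[OF as'] by auto
  obtain \<rho> where \<rho>: "\<rho> permutes {..<length bs}" "permute_list \<rho> bs = bs'"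
    using mset_eq_permutation[OF bs'] by auto
  have "length as' = length bs" using mset_eq_length[OF as'] assms by simp
  then have "dist_2_inf_list as' bs' = dist_2_inf_list as' bs"
    using dist_2_inf_list_permute_right[OF \<rho>(1)] \<rho>(2) by simp
  also have "\<dots> = dist_2_inf_list as bs"
    using dist_2_inf_list_permute_left[OF \<pi>(1) assms] \<pi>(2) by simp
  finally show ?thesis by (simp add: dist_2_inf_def as'_def bs'_def)
qed

end

theory Submission
  imports Defs
begin

text \<open>
  Constant collections located near the barycenter are feasible, so a minimizer \<open>A\<close> has objective
  at most the standard deviation \<open>\<sigma>\<close> of the measure (the barycenter itself need only be approached:
  membership in the closure of the hull of the support is enough). The regularizer then puts every
  point of \<open>A\<close> within \<open>r = s * \<sigma>\<close> of its mean \<open>m\<close>, where \<open>s = sqrt (k / \<alpha>)\<close>. Therefore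
  \<open>norm (x - m) \<le> infdist x (co A) + r\<close> for all \<open>x\<close>, and integrating the square of this inequality,
  expanded by Young's inequality with weight \<open>s\<close>, bounds the squared distance from \<open>m\<close> to the
  barycenter by \<open>(2 * s + s\<^sup>2) * \<sigma>\<^sup>2\<close>. The claimed bound follows for every \<open>\<alpha> \<ge> 1\<close>.
\<close>

section \<open>Support and barycenter of the measure\<close>

text \<open>The complement of the support is the union of all open null sets. Lindelof reduces it to
  a countable union, which is again null.\<close>

lemma AE_in_msupport:
  fixes \<nu> :: "'a::second_countable_topology measure"
  assumes "sets \<nu> = sets borel"
  shows "AE x in \<nu>. x \<in> msupport \<nu>"
proof -
  let ?F = "{U. open U \<and> emeasure \<nu> U = 0}"
  obtain F' where F': "F' \<subseteq> ?F" "countable F'" "\<Union>F' = \<Union>?F"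
    by (rule Lindelof[of ?F]) auto
  have "AE x in \<nu>. \<forall>U\<in>F'. x \<notin> U"
    unfolding AE_ball_countable[OF F'(2)]
  proof
    fix U assume "U \<in> F'"
    then have "U \<in> null_sets \<nu>" using F'(1) assms by (auto simp: null_sets_def)
    then show "AE x in \<nu>. x \<notin> U" by (rule AE_not_in)
  qed
  then show ?thesis
  proof (rule AE_mp, intro AE_I2 impI)
    fix x assume "\<forall>U\<in>F'. x \<notin> U"
    then have "x \<notin> \<Union>?F" using F'(3) by blast
    then show "x \<in> msupport \<nu>"
      by (auto simp: msupport_def zero_less_iff_neq_zero)
  qed
qed

text \<open>Strict separation by a hyperplane: a linear functional above \<open>b\<close> on
  \<open>C\<close> has integral at least \<open>b\<close>, yet its integral is its value at the
  barycenter, which is below \<open>b\<close>.\<close>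

lemma barycenter_in_closed_convex:
  fixes \<nu> :: "'a::euclidean_space measure"
  assumes "prob_space \<nu>" and int: "integrable \<nu> (\<lambda>x. x)"
    and "closed C" "convex C" and AE: "AE x in \<nu>. x \<in> C"
  shows "barycenter \<nu> \<in> C"
proof (rule ccontr)
  interpret prob_space \<nu> by fact
  assume "barycenter \<nu> \<notin> C"
  then obtain a b where ab: "a \<bullet> barycenter \<nu> < b" "\<And>x. x \<in> C \<Longrightarrow> a \<bullet> x > b"
    using separating_hyperplane_closed_point[OF assms(4,3)] by blast
  have "(\<integral>x. b \<partial>\<nu>) \<le> (\<integral>x. a \<bullet> x \<partial>\<nu>)"
  proof (rule integral_mono_AE)
    show "AE x in \<nu>. b \<le> a \<bullet> x"
      using AE by eventually_elim (rule less_imp_le, rule ab(2))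
  qed (use int in auto)
  also have "\<dots> = a \<bullet> barycenter \<nu>"
    unfolding barycenter_def by (rule integral_inner_right) (rule int)
  finally show False using ab(1) by (simp add: prob_space)
qed

lemma barycenter_in_closure_convex_hull:
  fixes \<nu> :: "'a::euclidean_space measure"
  assumes "prob_space \<nu>" "sets \<nu> = sets borel" "integrable \<nu> (\<lambda>x. x)"
  shows "barycenter \<nu> \<in> closure (convex hull (msupport \<nu>))"
proof (rule barycenter_in_closed_convex[OF assms(1,3)])
  show "AE x in \<nu>. x \<in> closure (convex hull (msupport \<nu>))"
    using AE_in_msupport[OF assms(2)] by eventually_elim (meson closure_subset hull_subset subsetD)
qed (auto intro: convex_closure)

lemma integrable_of_square:
  fixes \<nu> :: "'a::euclidean_space measure"
  assumes "prob_space \<nu>" "sets \<nu> = sets borel" "integrable \<nu> (\<lambda>x. (norm x)\<^sup>2)"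
  shows "integrable \<nu> (\<lambda>x. x)"
proof -
  interpret prob_space \<nu> by fact
  have "integrable \<nu> (\<lambda>x. 1 + (norm x)\<^sup>2)"
    by (intro Bochner_Integration.integrable_add assms(3)) simp
  moreover have "(\<lambda>x. x) \<in> borel_measurable \<nu>"
    by (rule measurable_ident_sets[OF assms(2)])
  moreover have "norm x \<le> norm (1 + (norm x)\<^sup>2)" for x :: 'a
  proof -
    have "2 * norm x \<le> 1 + (norm x)\<^sup>2" using sum_squares_bound[of 1 "norm x"] by simp
    then have "norm x \<le> 1 + (norm x)\<^sup>2" using norm_ge_zero[of x] by linarith
    then show ?thesis by simp
  qed
  ultimately show ?thesis
    by (rule Bochner_Integration.integrable_bound[OF _ _ AE_I2])
qed

section \<open>Second moments and constant competitors\<close>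

text \<open>The parallel axis identity. It serves twice: it evaluates the objective at a constant
  collection, and it turns a bound on the second moment about the mean of a minimizer into a bound
  on the distance from that mean to the barycenter.\<close>

lemma second_moment_about:
  fixes \<nu> :: "'a::euclidean_space measure"
  assumes "prob_space \<nu>" "sets \<nu> = sets borel" "integrable \<nu> (\<lambda>x. (norm x)\<^sup>2)"
  shows "integrable \<nu> (\<lambda>x. (norm (x - y))\<^sup>2)"
    and "(\<integral>x. (norm (x - y))\<^sup>2 \<partial>\<nu>)
      = (\<integral>x. (norm (x - barycenter \<nu>))\<^sup>2 \<partial>\<nu>) + (norm (y - barycenter \<nu>))\<^sup>2"
proof -
  interpret prob_space \<nu> by fact
  have id: "integrable \<nu> (\<lambda>x. x)" by (rule integrable_of_square[OF assms])
  have *: "(norm (x - z))\<^sup>2 = (norm x)\<^sup>2 - 2 * (x \<bullet> z) + (norm z)\<^sup>2" for x z :: 'a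
    by (simp add: power2_norm_eq_inner inner_diff inner_commute algebra_simps)
  show "integrable \<nu> (\<lambda>x. (norm (x - y))\<^sup>2)"
    unfolding * using id assms(3) by auto
  \<comment> \<open>Used at \<open>z = y\<close> and at \<open>z = barycenter \<nu>\<close>; the
    difference of the two instances is a complete square.\<close>
  have E: "(\<integral>x. (norm (x - z))\<^sup>2 \<partial>\<nu>)
      = (\<integral>x. (norm x)\<^sup>2 \<partial>\<nu>) - 2 * (barycenter \<nu> \<bullet> z) + (norm z)\<^sup>2" for z
    unfolding * barycenter_def using id assms(3) by (simp add: prob_space)
  show "(\<integral>x. (norm (x - y))\<^sup>2 \<partial>\<nu>)
      = (\<integral>x. (norm (x - barycenter \<nu>))\<^sup>2 \<partial>\<nu>) + (norm (y - barycenter \<nu>))\<^sup>2"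
    unfolding E *[of y "barycenter \<nu>"]
    by (simp add: power2_norm_eq_inner[of "barycenter \<nu>"] inner_commute)
qed

text \<open>The hull of a constant collection is a single point and its regularizer vanishes. The
  bound \<open>k \<ge> 1\<close> excludes the empty collection, for which \<open>infdist\<close> is
  0 by convention.\<close>

lemma objective_replicate_mset:
  fixes \<nu> :: "'a::euclidean_space measure"
  assumes "k \<ge> 1"
  shows "objective \<nu> \<alpha> (replicate_mset k y) = sqrt (\<integral>x. (norm (x - y))\<^sup>2 \<partial>\<nu>)"
proof -
  have "(\<Sum>a\<in>#replicate_mset n y. a) = real n *\<^sub>R y" for n
    by (induction n) (auto simp: scaleR_add_left)
  then have "mset_mean (replicate_mset k y) = y"
    using assms by (simp add: mset_mean_def)
  then show ?thesis
    using assms by (simp add: objective_def infdist_def dist_norm)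
qed

lemma objective_solution_le:
  fixes \<nu> :: "'a::euclidean_space measure"
  assumes "prob_space \<nu>" "sets \<nu> = sets borel" "integrable \<nu> (\<lambda>x. (norm x)\<^sup>2)"
    and "k \<ge> 1" and A: "is_solution \<nu> k \<alpha> A"
  shows "objective \<nu> \<alpha> A \<le> sqrt (\<integral>x. (norm (x - barycenter \<nu>))\<^sup>2 \<partial>\<nu>)"
proof -
  let ?C = "convex hull (msupport \<nu>)"
  let ?V = "\<integral>x. (norm (x - barycenter \<nu>))\<^sup>2 \<partial>\<nu>"
  have le: "objective \<nu> \<alpha> A \<le> sqrt (?V + (norm (y - barycenter \<nu>))\<^sup>2)" if "y \<in> ?C" for y
  proof -
    have "objective \<nu> \<alpha> A \<le> objective \<nu> \<alpha> (replicate_mset k y)"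
      using A that by (force simp: is_solution_def is_arg_min_def not_less)
    then show ?thesis
      by (simp add: objective_replicate_mset[OF assms(4)] second_moment_about(2)[OF assms(1-3), of y])
  qed
  \<comment> \<open>Along feasible points tending to the barycenter, the excess term in
    \<open>le\<close> vanishes in the limit.\<close>
  have "barycenter \<nu> \<in> closure ?C"
    by (intro barycenter_in_closure_convex_hull integrable_of_square assms)
  then obtain f where f: "\<And>n. f n \<in> ?C" "f \<longlonglongrightarrow> barycenter \<nu>"
    by (auto simp: closure_sequential)
  have "(\<lambda>n. sqrt (?V + (norm (f n - barycenter \<nu>))\<^sup>2))
      \<longlonglongrightarrow> sqrt (?V + (norm (barycenter \<nu> - barycenter \<nu>))\<^sup>2)"
    by (intro tendsto_intros f(2))
  then have "(\<lambda>n. sqrt (?V + (norm (f n - barycenter \<nu>))\<^sup>2)) \<longlonglongrightarrow> sqrt ?V"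
    by simp
  then show ?thesis
    by (rule LIMSEQ_le_const) (use le f(1) in blast)
qed

section \<open>Localization of a minimizer\<close>

text \<open>Nonnegativity of \<open>(t * a - b)\<^sup>2 / t\<close> absorbs the cross term
  \<open>2 * a * b\<close>. The weight \<open>t\<close> stays free so that it can later balance the
  two errors.\<close>

lemma young_square:
  fixes a b t :: real
  assumes "t > 0"
  shows "(a + b)\<^sup>2 \<le> (1 + t) * a\<^sup>2 + (1 + 1 / t) * b\<^sup>2"
proof -
  have "0 \<le> (t * a - b)\<^sup>2 / t" using assms by simp
  also have "\<dots> = t * a\<^sup>2 + b\<^sup>2 / t - 2 * a * b"
    using assms by (simp add: field_simps power2_eq_square)
  finally show ?thesis by (simp add: power2_eq_square algebra_simps)
qed

lemma sum_mset_image_nonneg: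
  fixes f :: "'a \<Rightarrow> real"
  assumes "\<And>x. x \<in># A \<Longrightarrow> f x \<ge> 0"
  shows "(\<Sum>x\<in>#A. f x) \<ge> 0"
  using assms by (induction A) auto

text \<open>Triangle inequality through the mean \<open>m\<close> of \<open>A\<close>: the summand
  \<open>s\<close> accounts for the distance from \<open>a\<close> to \<open>m\<close>, the root for
  the distance from \<open>m\<close> to the barycenter.\<close>

lemma solution_near_barycenter:
  fixes \<nu> :: "'a::euclidean_space measure"
  assumes \<nu>: "prob_space \<nu>" "sets \<nu> = sets borel" "integrable \<nu> (\<lambda>x. (norm x)\<^sup>2)"
    and k: "k \<ge> 1" and \<alpha>: "\<alpha> > 0" and A: "is_solution \<nu> k \<alpha> A" and a: "a \<in># A"
  defines "s \<equiv> sqrt (real k / \<alpha>)"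
    and "\<sigma> \<equiv> sqrt (\<integral>x. (norm (x - barycenter \<nu>))\<^sup>2 \<partial>\<nu>)"
  shows "norm (a - barycenter \<nu>) \<le> (s + sqrt (2 * s + s\<^sup>2)) * \<sigma>"
proof -
  interpret prob_space \<nu> by fact
  define m where "m = mset_mean A"
  define r where "r = s * \<sigma>"
  let ?K = "convex hull (set_mset A)"
  let ?I = "\<integral>x. (infdist x ?K)\<^sup>2 \<partial>\<nu>"
  let ?S = "\<Sum>a\<in>#A. (norm (a - m))\<^sup>2"
  have s: "s > 0" "s\<^sup>2 = real k / \<alpha>" using k \<alpha> by (auto simp: s_def)
  have \<sigma>: "\<sigma> \<ge> 0" "\<sigma>\<^sup>2 = (\<integral>x. (norm (x - barycenter \<nu>))\<^sup>2 \<partial>\<nu>)" by (auto simp: \<sigma>_def)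
  have size: "size A = k" using A by (auto simp: is_solution_def is_arg_min_def)
  have I0: "?I \<ge> 0" by simp
  have S0: "?S \<ge> 0" by (auto intro!: sum_mset_image_nonneg)
  have obj: "?I + \<alpha> / real k * ?S \<le> \<sigma>\<^sup>2"
    using objective_solution_le[OF \<nu> k A]
    by (simp add: objective_def size \<sigma>(2) m_def)
  \<comment> \<open>Both terms of \<open>obj\<close> are nonnegative, so each alone is at most
    \<open>\<sigma>\<^sup>2\<close>; solving the second for \<open>?S\<close> produces the factor
    \<open>k / \<alpha>\<close>, which is \<open>s\<^sup>2\<close>.\<close>
  have I_le: "?I \<le> \<sigma>\<^sup>2"
    using obj S0 \<alpha> k by (smt (verit) divide_nonneg_nonneg mult_nonneg_nonneg of_nat_0_le_iff)
  have "?S \<le> s\<^sup>2 * \<sigma>\<^sup>2"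
  proof -
    have "\<alpha> / real k * ?S \<le> \<sigma>\<^sup>2" using obj I0 by linarith
    then show ?thesis using \<alpha> k unfolding s(2) by (simp add: field_simps)
  qed
  then have S_le: "?S \<le> r\<^sup>2" by (simp add: r_def power_mult_distrib)
  have r: "r \<ge> 0" using s \<sigma> by (simp add: r_def)
  \<comment> \<open>One summand is at most the whole sum. As the regularizer is an average over
    \<open>k\<close> points, this costs the factor \<open>k\<close> inside \<open>s\<close>.\<close>
  have near: "norm (b - m) \<le> r" if b: "b \<in># A" for b
  proof -
    obtain B where B: "A = add_mset b B" using multi_member_split[OF b] by blast
    have "0 \<le> (\<Sum>a\<in>#B. (norm (a - m))\<^sup>2)" by (auto intro!: sum_mset_image_nonneg)
    then have "(norm (b - m))\<^sup>2 \<le> r\<^sup>2" using S_le unfolding B by simp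
    then show ?thesis using r by (rule power2_le_imp_le)
  qed
  \<comment> \<open>Balls are convex, so the hull inherits the bound \<open>near\<close>; a nearest
    point of the compact hull then yields \<open>far\<close>.\<close>
  have "?K \<subseteq> cball m r"
    using near by (intro hull_minimal) (auto simp: dist_norm norm_minus_commute)
  moreover have K: "compact ?K" "?K \<noteq> {}"
    using a by (auto intro: finite_imp_compact_convex_hull)
  ultimately have far: "norm (x - m) \<le> infdist x ?K + r" for x
  proof -
    obtain y where y: "y \<in> ?K" "infdist x ?K = dist x y"
      using infdist_attains_inf[OF compact_imp_closed[OF K(1)] K(2)] by metis
    have "dist m y \<le> r" using y(1) \<open>?K \<subseteq> cball m r\<close> by auto
    then show ?thesis using dist_triangle[of x m y] y(2) by (simp add: dist_norm norm_minus_commute)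
  qed
  \<comment> \<open>Since \<open>a\<close> lies in the hull, the distance to \<open>a\<close>
    dominates; integrability is what allows the integral below to be split.\<close>
  have int: "integrable \<nu> (\<lambda>x. (infdist x ?K)\<^sup>2)"
  proof (rule Bochner_Integration.integrable_bound)
    show "integrable \<nu> (\<lambda>x. (norm (x - a))\<^sup>2)" by (rule second_moment_about(1)[OF \<nu>])
    have "(\<lambda>x. (infdist x ?K)\<^sup>2) \<in> borel_measurable borel"
      by (intro borel_measurable_continuous_onI continuous_intros)
    then show "(\<lambda>x. (infdist x ?K)\<^sup>2) \<in> borel_measurable \<nu>"
      by (simp add: measurable_cong_sets[OF \<nu>(2)])
    have "infdist x ?K \<le> norm (x - a)" for x
      using infdist_le[of a ?K x] a by (simp add: hull_inc dist_norm)
    then show "AE x in \<nu>. norm ((infdist x ?K)\<^sup>2) \<le> norm ((norm (x - a))\<^sup>2)"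
      by (simp add: infdist_nonneg power_mono)
  qed
  have "\<sigma>\<^sup>2 + (norm (m - barycenter \<nu>))\<^sup>2 = (\<integral>x. (norm (x - m))\<^sup>2 \<partial>\<nu>)"
    by (simp add: second_moment_about(2)[OF \<nu>, of m] \<sigma>(2))
  \<comment> \<open>Why the weight is \<open>s\<close>: as \<open>r = s * \<sigma>\<close>, the
    remainder \<open>(1 + 1 / s) * r\<^sup>2\<close> equals
    \<open>(s + s\<^sup>2) * \<sigma>\<^sup>2\<close>, whose leading term matches the extra
    \<open>s * \<sigma>\<^sup>2\<close> from the first summand.\<close>
  also have "\<dots> \<le> (\<integral>x. (1 + s) * (infdist x ?K)\<^sup>2 + (1 + 1 / s) * r\<^sup>2 \<partial>\<nu>)"
  proof (rule integral_mono)
    show "integrable \<nu> (\<lambda>x. (norm (x - m))\<^sup>2)" by (rule second_moment_about(1)[OF \<nu>])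
    show "integrable \<nu> (\<lambda>x. (1 + s) * (infdist x ?K)\<^sup>2 + (1 + 1 / s) * r\<^sup>2)" using int by simp
    show "(norm (x - m))\<^sup>2 \<le> (1 + s) * (infdist x ?K)\<^sup>2 + (1 + 1 / s) * r\<^sup>2" for x
      using power_mono[OF far[of x], of 2] young_square[OF s(1), of "infdist x ?K" r] by simp
  qed
  also have "\<dots> = (1 + s) * ?I + (1 + 1 / s) * r\<^sup>2" using int by (simp add: prob_space)
  also have "\<dots> \<le> (1 + s) * \<sigma>\<^sup>2 + (1 + 1 / s) * r\<^sup>2"
    using I_le s(1) by (intro add_right_mono mult_left_mono) auto
  also have "\<dots> = \<sigma>\<^sup>2 + (2 * s + s\<^sup>2) * \<sigma>\<^sup>2"
    using s(1) by (simp add: r_def field_simps power2_eq_square)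
  finally have "(norm (m - barycenter \<nu>))\<^sup>2 \<le> (2 * s + s\<^sup>2) * \<sigma>\<^sup>2" by simp
  then have "norm (m - barycenter \<nu>) \<le> sqrt ((2 * s + s\<^sup>2) * \<sigma>\<^sup>2)" by (rule real_le_rsqrt)
  then have "norm (m - barycenter \<nu>) \<le> sqrt (2 * s + s\<^sup>2) * \<sigma>"
    using \<sigma>(1) by (simp add: real_sqrt_mult)
  then show ?thesis
    using near[OF a] norm_triangle_ineq[of "a - m" "m - barycenter \<nu>"]
    by (simp add: r_def algebra_simps)
qed

section \<open>The matching distance and the numerical constant\<close>

text \<open>Against copies of a single point all matchings cost the same, so the identity
  permutation serves as witness for the minimum. With \<open>k \<ge> 1\<close> the maximum ranges
  over a nonempty set.\<close>

lemma dist_2_inf_replicate_mset_le: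
  fixes A :: "'a::euclidean_space multiset"
  assumes "k \<ge> 1" "size A = k" and le: "\<And>a. a \<in># A \<Longrightarrow> norm (a - x) \<le> c"
  shows "dist_2_inf A (replicate_mset k x) \<le> c"
proof -
  obtain as where as: "mset as = A" by (metis ex_mset)
  have len: "length as = k" using as assms(2) by auto
  let ?f = "\<lambda>\<sigma>. MAX l\<in>{..<k}. norm (as ! \<sigma> l - replicate k x ! l)"
  have "dist_2_inf A (replicate_mset k x) = dist_2_inf_list as (replicate k x)"
    using dist_2_inf_mset[of as "replicate k x"] as len by simp
  also have "\<dots> = (MIN \<sigma>\<in>{\<sigma>. \<sigma> permutes {..<k}}. ?f \<sigma>)" by (simp add: dist_2_inf_list_def)
  also have "\<dots> \<le> ?f id"
    by (intro Min_le finite_imageI finite_permutations imageI) (auto simp: permutes_id[unfolded id_def])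
  also have "\<dots> \<le> c"
  proof (rule Max.boundedI)
    fix u assume "u \<in> (\<lambda>l. norm (as ! id l - replicate k x ! l)) ` {..<k}"
    then obtain l where "l < k" "u = norm (as ! l - x)" by auto
    then show "u \<le> c" using le len as by (metis nth_mem_mset)
  qed (use assms(1) in \<open>auto simp: lessThan_empty_iff\<close>)
  finally show ?thesis .
qed

text \<open>In terms of \<open>q = \<alpha> powr (- 1 / 4)\<close>, \<open>s\<close> is
  \<open>sqrt k * q\<^sup>2\<close>, so the root of \<open>2 * s\<close> is of order
  \<open>q\<close> and dictates the exponent. The two summands are at most 1 and 2 times
  \<open>sqrt k * q\<close>, well within the factor 8.\<close>

lemma radius_bound:
  fixes \<alpha> :: real
  assumes "k \<ge> 1" "\<alpha> \<ge> 1"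
  defines "s \<equiv> sqrt (real k / \<alpha>)"
  shows "s + sqrt (2 * s + s\<^sup>2) \<le> 8 * sqrt (real k) * \<alpha> powr (- 1 / 4)"
proof -
  define q where "q = \<alpha> powr (- 1 / 4)"
  have q: "q > 0" "q \<le> 1" using assms powr_mono[of "- 1 / 4" 0 \<alpha>] by (auto simp: q_def)
  have "q\<^sup>2 = \<alpha> powr (- 1 / 2)" by (simp add: q_def power2_eq_square flip: powr_add)
  also have "\<dots> = 1 / sqrt \<alpha>" using assms by (simp add: powr_minus_divide powr_half_sqrt)
  finally have s: "s = sqrt (real k) * q\<^sup>2" by (simp add: s_def real_sqrt_divide)
  have qq: "q\<^sup>2 \<le> q" using q by (simp add: power2_eq_square mult_left_le)
  have s_le: "s \<le> sqrt (real k) * q" unfolding s using qq by (intro mult_left_mono) auto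
  have "s \<ge> 0" using q by (simp add: s)
  \<comment> \<open>Replacing \<open>sqrt k\<close> by \<open>k\<close> puts \<open>s\<close> and
    \<open>s\<^sup>2\<close> under the common bound \<open>k * q\<^sup>2\<close>.\<close>
  have "sqrt (real k) \<le> sqrt (real k) * sqrt (real k)"
    using assms(1) by (intro mult_le_cancel_left1[THEN iffD2]) auto
  then have "sqrt (real k) \<le> real k" by simp
  then have "s \<le> real k * q\<^sup>2" unfolding s by (intro mult_right_mono) auto
  moreover have "s\<^sup>2 \<le> real k * q\<^sup>2"
    using power_mono[OF s_le \<open>s \<ge> 0\<close>, of 2] by (simp add: power_mult_distrib)
  \<comment> \<open>The bounds add up to 3 times this quantity; its sign allows rounding up to 4, a
    perfect square.\<close>
  moreover have "0 \<le> real k * q\<^sup>2" by simp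
  ultimately have "2 * s + s\<^sup>2 \<le> 4 * (real k * q\<^sup>2)" by linarith
  then have "2 * s + s\<^sup>2 \<le> (2 * (sqrt (real k) * q))\<^sup>2" by (simp add: power_mult_distrib)
  then have "sqrt (2 * s + s\<^sup>2) \<le> 2 * (sqrt (real k) * q)" using q by (intro real_le_lsqrt) auto
  moreover have "0 \<le> sqrt (real k) * q" using q by simp
  ultimately show ?thesis using s_le unfolding q_def[symmetric] mult.assoc by linarith
qed

theorem theorem1p14:
  fixes \<nu> :: "(real ^ 'd) measure" and k :: nat
  assumes "k \<ge> 1"
    and "prob_space \<nu>"
    and "sets \<nu> = sets borel"
    and "integrable \<nu> (\<lambda>x. (norm x)\<^sup>2)"
  shows "\<forall>\<^sub>F \<alpha> in at_top. \<forall>A. is_solution \<nu> k \<alpha> A \<longrightarrow>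
    dist_2_inf A (replicate_mset k (barycenter \<nu>))
      \<le> 8 * sqrt (real k) * \<alpha> powr (- 1 / 4) * sqrt (\<integral>x. (norm (x - barycenter \<nu>))\<^sup>2 \<partial>\<nu>)"
  using eventually_ge_at_top[of 1]
proof eventually_elim
  \<comment> \<open>The threshold 1 for \<alpha> is the one at which \<open>q \<le> 1\<close> holds
    in \<open>radius_bound\<close>; it also gives positivity of \<alpha>.\<close>
  case (elim \<alpha>)
  show ?case
  proof (intro allI impI)
    fix A assume A: "is_solution \<nu> k \<alpha> A"
    show "dist_2_inf A (replicate_mset k (barycenter \<nu>))
      \<le> 8 * sqrt (real k) * \<alpha> powr (- 1 / 4) * sqrt (\<integral>x. (norm (x - barycenter \<nu>))\<^sup>2 \<partial>\<nu>)"
    proof (rule dist_2_inf_replicate_mset_le[OF assms(1)])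
      show "size A = k" using A by (auto simp: is_solution_def is_arg_min_def)
      fix a assume a: "a \<in># A"
      have "0 < \<alpha>" using elim by simp
      from solution_near_barycenter[OF assms(2-4,1) this A a]
      show "norm (a - barycenter \<nu>)
        \<le> 8 * sqrt (real k) * \<alpha> powr (- 1 / 4) * sqrt (\<integral>x. (norm (x - barycenter \<nu>))\<^sup>2 \<partial>\<nu>)"
        by (rule order_trans) (intro mult_right_mono radius_bound assms(1) elim, simp)
    qed
  qed
qed

end
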